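(* Let $x\in\{0,1\}^{\mathbb Z}$ be a nonzero configuration with finite support. Then no column of the orbit of $x$ is eventually constant: there do not exist $i\in\mathbb Z$, $a\in\{0,1\}$ and $T\ge 0$ such that $F^t(x)_i=a$ for all $t\ge T$.
   Context: Rule 30 is the map $F:\{0,1\}^{\mathbb Z}\to\{0,1\}^{\mathbb Z}$ given by $F(x)_i=x_{i-1}\oplus(x_i\lor x_{i+1})$, where $\oplus$ is addition modulo $2$ and $\lor$ is Boolean disjunction. $F^t$ is the $t$-fold iterate, with $F^0(x)=x$. A configuration $x$ has finite support if $\{i\in\mathbb Z:x_i=1\}$ is finite. Column $i$ of the orbit of $x$ is the sequence $(F^t(x)_i)_{t\ge 0}$. *)

theory Defs
  imports Main
begin

type_synonym config = "int \<Rightarrow> bool"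

(* The bits 0 and 1 are False and True, so addition modulo 2 is inequality of truth values. *)
definition rule30 :: "config \<Rightarrow> config" where
  "rule30 x = (\<lambda>i. x (i - 1) \<noteq> (x i \<or> x (i + 1)))"

definition finite_support :: "config \<Rightarrow> bool" where
  "finite_support x \<longleftrightarrow> finite {i. x i}"

definition column :: "config \<Rightarrow> int \<Rightarrow> nat \<Rightarrow> bool" where
  "column x i = (\<lambda>t. (rule30 ^^ t) x i)"

definition eventually_constant :: "(nat \<Rightarrow> 'a) \<Rightarrow> bool" where
  "eventually_constant s \<longleftrightarrow> (\<exists>a T. \<forall>t\<ge>T. s t = a)"

end

theory Submission
  imports Defs
begin

text \<open>
  Rule 30 is left permutive: solving the rule for its left input expresses a column of an orbit
  through the two columns to its right. Eventual knowledge of columns therefore propagates to the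
  left without any delay, so it holds everywhere on the left from one common time on. On the other
  hand the leftmost one of a configuration moves left by exactly one cell per step, so at every
  time the far left is zero, and at late times the leftmost one lies left of any given column.

  If a column is eventually one, then the rule forces its left neighbour to be eventually zero and
  the next column to be eventually one, whatever happens on the right. Hence every second column
  on the left is one from a common time on, although the far left is zero at that time
  (\<open>ones_left\<close>, \<open>not_eventually_one\<close>). If a column is eventually zero, then the next
  value of its right neighbour is the disjunction of two current values, one of them its own. So
  the right neighbour is eventually constant: it cannot be eventually one by the first case, and if
  it is eventually zero, two adjacent zero columns make everything on the left zero from a common
  time on, although the leftmost one lies there at late times
  (\<open>zeros_left\<close>, \<open>not_eventually_two_zeros\<close>).
\<close>

lemma column_Suc:
  "column x i (Suc t) \<longleftrightarrow> column x (i - 1) t \<noteq> (column x i t \<or> column x (i + 1) t)"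
  by (simp add: column_def rule30_def)

lemma column_left:
  "column x (i - 1) t \<longleftrightarrow> column x i (Suc t) \<noteq> (column x i t \<or> column x (i + 1) t)"
  using column_Suc[of x i t] by blast

definition leftmost_one :: "config \<Rightarrow> int \<Rightarrow> bool" where
  "leftmost_one x l \<longleftrightarrow> x l \<and> (\<forall>j<l. \<not> x j)"

lemma finite_support_leftmost_one:
  assumes "x \<noteq> (\<lambda>_. False)" "finite_support x"
  obtains l where "leftmost_one x l"
proof
  have fin: "finite {i. x i}" and "{i. x i} \<noteq> {}"
    using assms by (auto simp: finite_support_def fun_eq_iff)
  then have "Min {i. x i} \<in> {i. x i}"
    by (rule Min_in)
  moreover have "\<not> x j" if "j < Min {i. x i}" for j
    using that Min_le[OF fin, of j] by auto
  ultimately show "leftmost_one x (Min {i. x i})"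
    by (simp add: leftmost_one_def)
qed

text \<open>
  The cell left of the leftmost one sees the neighbourhood 0, 0, 1 and becomes one; all cells
  further left see only zeros.
\<close>

lemma leftmost_one_column:
  assumes "leftmost_one x l"
  shows "column x (l - int t) t \<and> (\<forall>j < l - int t. \<not> column x j t)"
proof (induction t)
  case 0
  then show ?case
    using assms by (simp add: leftmost_one_def column_def)
next
  case (Suc t)
  have shift: "l - int (Suc t) + 1 = l - int t"
    by simp
  show ?case
    using Suc.IH by (auto simp: column_Suc shift)
qed

lemma ones_left:
  assumes "\<forall>t\<ge>T. column x i t"
  shows "\<forall>t\<ge>T. column x (i - 2 * int n) t"
proof (induction n)
  case 0
  then show ?case
    using assms by simp
next
  case (Suc n)
  let ?j = "i - 2 * int n"
  have zero: "\<not> column x (?j - 1) t" if "t \<ge> T" for t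
    using Suc.IH that column_left[of x ?j t] by simp
  have "column x (?j - 1 - 1) t" if "t \<ge> T" for t
    using Suc.IH that zero[of t] zero[of "Suc t"] column_left[of x "?j - 1" t] by simp
  then show ?case
    by (simp add: algebra_simps)
qed

lemma not_eventually_one:
  assumes "leftmost_one x l"
  shows "\<not> (\<forall>t\<ge>T. column x i t)"
proof
  assume ones: "\<forall>t\<ge>T. column x i t"
  \<comment> \<open>A number of double steps that leads from \<open>i\<close> past the leftmost one at time \<open>T\<close>.\<close>
  define n where "n = nat (i - l + int T + 1)"
  have "i - 2 * int n < l - int T"
    by (simp add: n_def)
  then show False
    using ones_left[OF ones, of n] leftmost_one_column[OF assms, of T] by blast
qed

lemma zeros_left:
  assumes "\<forall>t\<ge>T. \<not> column x i t" "\<forall>t\<ge>T. \<not> column x (i + 1) t"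
  shows "\<forall>t\<ge>T. \<not> column x (i - int n) t \<and> \<not> column x (i - int n + 1) t"
proof (induction n)
  case 0
  then show ?case
    using assms by simp
next
  case (Suc n)
  have "\<not> column x (i - int n - 1) t" if "t \<ge> T" for t
    using Suc.IH that column_left[of x "i - int n" t] by simp
  with Suc.IH show ?case
    by (simp add: algebra_simps)
qed

lemma not_eventually_two_zeros:
  assumes "leftmost_one x l"
    and "\<forall>t\<ge>T. \<not> column x i t" "\<forall>t\<ge>T. \<not> column x (i + 1) t"
  shows False
proof -
  \<comment> \<open>A time from \<open>T\<close> on at which the leftmost one has reached or passed column \<open>i\<close>.\<close>
  define t where "t = max T (nat (l - i))"
  have "i - int (nat (i - (l - int t))) = l - int t" and "t \<ge> T"
    by (auto simp: t_def)
  then show False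
    using zeros_left[OF assms(2,3), of "nat (i - (l - int t))"] leftmost_one_column[OF assms(1), of t]
    by auto
qed

text \<open>
  With a zero to its left, a cell becomes the disjunction of itself and its right neighbour, so it
  can turn from zero to one but never back.
\<close>

lemma right_of_zero_column:
  assumes "\<forall>t\<ge>T. \<not> column x i t"
  shows "(\<forall>t\<ge>T. \<not> column x (i + 1) t) \<or> (\<exists>S. \<forall>t\<ge>S. column x (i + 1) t)"
proof (cases "\<exists>S\<ge>T. column x (i + 1) S")
  case True
  then obtain S where S: "S \<ge> T" "column x (i + 1) S"
    by blast
  have "column x (i + 1) t" if "t \<ge> S" for t
    using that
  proof (induction t rule: dec_induct)
    case base
    show ?case
      by (rule S(2))
  next
    case (step t)
    then show ?case
      using assms S(1) column_Suc[of x "i + 1" t] by simp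
  qed
  then show ?thesis
    by blast
qed blast

theorem corollary5:
  fixes x :: config
  assumes "x \<noteq> (\<lambda>_. False)"
    and "finite_support x"
  shows "\<not> (\<exists>i. eventually_constant (column x i))"
proof
  assume "\<exists>i. eventually_constant (column x i)"
  then obtain i a T where const: "\<forall>t\<ge>T. column x i t = a"
    by (auto simp: eventually_constant_def)
  obtain l where l: "leftmost_one x l"
    using finite_support_leftmost_one[OF assms] .
  have zero: "\<forall>t\<ge>T. \<not> column x i t"
    using const not_eventually_one[OF l, of T i] by (cases a) auto
  then have "\<forall>t\<ge>T. \<not> column x (i + 1) t"
    using right_of_zero_column[OF zero] not_eventually_one[OF l] by blast
  then show False
    using not_eventually_two_zeros[OF l zero] by blast
qed

end
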